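(* Let $G$ be a graph with vertex set $V(G)=\{x_1,\dots,x_n\}$, let $\mathbb{K}$ be a field, let $S=\mathbb{K}[x_1,\dots,x_n]$, and let $I(G)\subseteq S$ be the edge ideal of $G$. Then $\mathrm{reg}(S/I(G))\leq \nu_o(G)$, where $\nu_o(G)$ is the ordered matching number of $G$.
   Context: Graphs are finite and simple; the vertices of $G$ are identified with the variables of $S$. The edge ideal $I(G)$ is the ideal of $S$ generated by the squarefree monomials $x_ix_j$ with $\{x_i,x_j\}\in E(G)$. Ordered matching: a nonempty matching $M=\{\{a_i,b_i\}\mid 1\leq i\leq r\}$ of $G$ (a set of pairwise disjoint edges, with a chosen labelling of the edges and their endpoints) is an ordered matching if (1) $\{a_1,\dots,a_r\}$ is an independent set of vertices of $G$, and (2) $\{a_i,b_j\}\in E(G)$ implies $i\leq j$. The ordered matching number $\nu_o(G)$ is the maximum of $|M|$ over all ordered matchings $M$ of $G$, with $\nu_o(G)=0$ if $G$ has no edges. Regularity: for a finitely generated graded $S$-module $M$ (standard grading), $\mathrm{reg}(M)=\max\{j-i\mid \mathrm{Tor}_i^S(\mathbb{K},M)_j\neq 0\}$. *)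

theory Defs
  imports
    "HOL-Library.Poly_Mapping"
    "HOL-Library.Extended_Real"
begin

section \<open>The polynomial ring\<close>

text \<open>
  With \<open>'v\<close> a finite type of variables and \<open>'k\<close> a field, \<open>('v, 'k) mpoly\<close> is the polynomial ring
  \<open>S = K[x\<^sub>1, \<dots>, x\<^sub>n]\<close>, where \<open>n = CARD('v)\<close>. An exponent vector has type
  \<open>'v \<Rightarrow>\<^sub>0 nat\<close>.
\<close>

type_synonym ('v, 'k) mpoly = "('v \<Rightarrow>\<^sub>0 nat) \<Rightarrow>\<^sub>0 'k"

definition var :: "'v \<Rightarrow> ('v, 'k::field) mpoly" where
  "var x = Poly_Mapping.single (Poly_Mapping.single x 1) 1"

definition monom_degree :: "('v \<Rightarrow>\<^sub>0 nat) \<Rightarrow> nat" where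
  "monom_degree m = (\<Sum>x\<in>Poly_Mapping.keys m. Poly_Mapping.lookup m x)"

text \<open>The graded piece \<open>S\<^sub>d\<close> of the standard grading; it is zero for \<open>d < 0\<close>.\<close>

definition graded_piece :: "int \<Rightarrow> ('v, 'k::field) mpoly set" where
  "graded_piece d = {p. \<forall>m\<in>Poly_Mapping.keys p. int (monom_degree m) = d}"

definition ideal_generated :: "('v, 'k::field) mpoly set \<Rightarrow> ('v, 'k) mpoly set" where
  "ideal_generated A = module.span (*) A"


section \<open>Graded free resolutions of the residue field\<close>

text \<open>
  A complex \<open>\<dots> \<rightarrow> P\<^sub>2 \<rightarrow> P\<^sub>1 \<rightarrow> P\<^sub>0 \<rightarrow> K\<close> of finitely generated graded free modules: \<open>P\<^sub>i\<close> has the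
  basis \<open>(e\<^sub>k)\<close> for \<open>k < rank i\<close>, with \<open>e\<^sub>k\<close> in degree \<open>shift i k\<close>. The coefficient of
  \<open>e\<^sub>l\<close> in the image of \<open>e\<^sub>k\<close> under \<open>P\<^sub>i\<^sub>+\<^sub>1 \<rightarrow> P\<^sub>i\<close> is \<open>matrix i k l\<close>, and \<open>e\<^sub>k\<close> in \<open>P\<^sub>0\<close>
  is sent to \<open>augment k\<close> in \<open>K\<close>.
\<close>

record (overloaded) ('v, 'k) free_complex =
  rank :: "nat \<Rightarrow> nat"
  shift :: "nat \<Rightarrow> nat \<Rightarrow> int"
  matrix :: "nat \<Rightarrow> nat \<Rightarrow> nat \<Rightarrow> ('v, 'k) mpoly"
  augment :: "nat \<Rightarrow> 'k"

definition free_module :: "nat \<Rightarrow> (nat \<Rightarrow> ('v, 'k::field) mpoly) set" where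
  "free_module r = {v. \<forall>k\<ge>r. v k = 0}"

text \<open>\<open>boundary P i\<close> is the map \<open>P\<^sub>i\<^sub>+\<^sub>1 \<rightarrow> P\<^sub>i\<close>.\<close>

definition boundary ::
    "('v, 'k::field) free_complex \<Rightarrow> nat \<Rightarrow> (nat \<Rightarrow> ('v, 'k) mpoly) \<Rightarrow> nat \<Rightarrow> ('v, 'k) mpoly" where
  "boundary P i v =
     (\<lambda>l. if l < rank P i then \<Sum>k<rank P (Suc i). v k * matrix P i k l else 0)"

text \<open>A polynomial acts on \<open>K = S/(x\<^sub>1, \<dots>, x\<^sub>n)\<close> through its constant coefficient.\<close>

definition augmentation ::
    "('v, 'k::field) free_complex \<Rightarrow> (nat \<Rightarrow> ('v, 'k) mpoly) \<Rightarrow> 'k" where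
  "augmentation P v = (\<Sum>k<rank P 0. Poly_Mapping.lookup (v k) 0 * augment P k)"

definition residue_field_resolution :: "('v, 'k::field) free_complex \<Rightarrow> bool" where
  "residue_field_resolution P \<longleftrightarrow>
     (\<forall>i. \<forall>k<rank P (Suc i). \<forall>l<rank P i.
        matrix P i k l \<in> graded_piece (shift P (Suc i) k - shift P i l)) \<and>
     (\<forall>k<rank P 0. augment P k \<noteq> 0 \<longrightarrow> shift P 0 k = 0) \<and>
     augmentation P ` free_module (rank P 0) = UNIV \<and>
     {v \<in> free_module (rank P 0). augmentation P v = 0} =
       boundary P 0 ` free_module (rank P (Suc 0)) \<and>
     (\<forall>i. {v \<in> free_module (rank P (Suc i)). boundary P i v = (\<lambda>_. 0)} =
       boundary P (Suc i) ` free_module (rank P (Suc (Suc i))))"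


section \<open>Tor and regularity\<close>

text \<open>
  Since \<open>P\<^sub>i\<close> is free, \<open>P\<^sub>i \<otimes> S/I = (S/I)\<^bsup>rank i\<^esup>\<close>. Its elements are represented by vectors over \<open>S\<close>,
  to be read modulo \<open>I\<close> in each entry; the degree \<open>j\<close> part consists of the vectors whose \<open>k\<close>-th
  entry has degree \<open>j - shift i k\<close>. Thus \<open>Tor\<^sub>i(K, S/I)\<^sub>j\<close>, the degree \<open>j\<close> part of the \<open>i\<close>-th homology
  of \<open>P \<otimes> S/I\<close>, is the quotient of \<open>tor_cycles P I i j\<close> by \<open>tor_boundaries P I i j\<close>.
\<close>

definition tensor_chains ::
    "('v, 'k::field) free_complex \<Rightarrow> nat \<Rightarrow> int \<Rightarrow> (nat \<Rightarrow> ('v, 'k) mpoly) set" where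
  "tensor_chains P i j =
     {v \<in> free_module (rank P i). \<forall>k<rank P i. v k \<in> graded_piece (j - shift P i k)}"

definition tor_cycles ::
    "('v, 'k::field) free_complex \<Rightarrow> ('v, 'k) mpoly set \<Rightarrow> nat \<Rightarrow> int
      \<Rightarrow> (nat \<Rightarrow> ('v, 'k) mpoly) set" where
  "tor_cycles P I i j =
     {v \<in> tensor_chains P i j.
        case i of 0 \<Rightarrow> True | Suc i' \<Rightarrow> \<forall>l<rank P i'. boundary P i' v l \<in> I}"

definition tor_boundaries ::
    "('v, 'k::field) free_complex \<Rightarrow> ('v, 'k) mpoly set \<Rightarrow> nat \<Rightarrow> int
      \<Rightarrow> (nat \<Rightarrow> ('v, 'k) mpoly) set" where
  "tor_boundaries P I i j =
     {v \<in> tensor_chains P i j.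
        \<exists>w\<in>tensor_chains P (Suc i) j. \<forall>k<rank P i. v k - boundary P i w k \<in> I}"

text \<open>
  \<open>Tor\<^sub>i(K, S/I)\<^sub>j \<noteq> 0\<close>, for a homogeneous ideal \<open>I\<close>. Tor does not depend on the resolution, so
  quantifying existentially or universally over the resolutions of \<open>K\<close> gives the same notion; one
  resolution of the required shape is the Koszul complex on the variables.
\<close>

definition tor_nonzero :: "('v, 'k::field) mpoly set \<Rightarrow> nat \<Rightarrow> int \<Rightarrow> bool" where
  "tor_nonzero I i j \<longleftrightarrow>
     (\<exists>P. residue_field_resolution P \<and> tor_cycles P I i j \<noteq> tor_boundaries P I i j)"

text \<open>
  The regularity of \<open>S/I\<close>. For a finitely generated nonzero module the supremum is a maximum; the
  extended reals give the zero module regularity \<open>-\<infinity>\<close>.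
\<close>

definition reg_quotient :: "('v, 'k::field) mpoly set \<Rightarrow> ereal" where
  "reg_quotient I = Sup {ereal (of_int (j - int i)) | i j. tor_nonzero I i j}"


section \<open>Graphs\<close>

text \<open>The vertex set is the type \<open>'v\<close> of variables; a graph is given by its edge set.\<close>

definition simple_graph :: "'v::finite set set \<Rightarrow> bool" where
  "simple_graph E \<longleftrightarrow> (\<forall>e\<in>E. card e = 2)"

definition edge_ideal :: "'v::finite set set \<Rightarrow> ('v, 'k::field) mpoly set" where
  "edge_ideal E = ideal_generated {var x * var y | x y. {x, y} \<in> E}"

definition matching :: "'v set set \<Rightarrow> 'v set set \<Rightarrow> bool" where
  "matching E M \<longleftrightarrow> M \<subseteq> E \<and> pairwise disjnt M"

definition independent_vertices :: "'v set set \<Rightarrow> 'v set \<Rightarrow> bool" where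
  "independent_vertices E A \<longleftrightarrow> (\<forall>x\<in>A. \<forall>y\<in>A. {x, y} \<notin> E)"

definition ordered_matching :: "'v set set \<Rightarrow> 'v set set \<Rightarrow> bool" where
  "ordered_matching E M \<longleftrightarrow> matching E M \<and> M \<noteq> {} \<and>
     (\<exists>r (a :: nat \<Rightarrow> 'v) b.
        M = (\<lambda>i. {a i, b i}) ` {1..r} \<and> inj_on (\<lambda>i. {a i, b i}) {1..r} \<and>
        independent_vertices E (a ` {1..r}) \<and>
        (\<forall>i\<in>{1..r}. \<forall>j\<in>{1..r}. {a i, b j} \<in> E \<longrightarrow> i \<le> j))"

definition ordered_matching_number :: "'v::finite set set \<Rightarrow> nat" where
  "ordered_matching_number E =
     (if E = {} then 0 else Max {card M | M. ordered_matching E M})"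

end

theory Submission imports Defs begin

text \<open>
  Choose a vertex \<open>x\<close> of an edge, with neighbourhood \<open>N\<close>. The sequence
  \<open>0 \<rightarrow> S/(I : x)(-1) \<rightarrow> S/I \<rightarrow> S/(I, x) \<rightarrow> 0\<close> gives \<open>reg (S/I) \<le> max (reg (S/(I : x)) + 1) (reg (S/(I, x)))\<close>.
  Both outer ideals are again edge ideals plus variables: deleting \<open>x\<close> does not increase the ordered
  matching number, and deleting \<open>x\<close> together with \<open>N\<close> decreases it, because an edge at \<open>x\<close> can
  be appended to an ordered matching of the rest. Induction on the number of edges ends with ideals
  generated by variables. Only half-exactness of \<open>Tor\<close> is used in the induction, so all arguments are
  direct computations with cycles in an arbitrary resolution of \<open>K\<close>.
\<close>

section \<open>Polynomials and squarefree monomial ideals\<close>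

abbreviation e1 :: "'v \<Rightarrow> 'v \<Rightarrow>\<^sub>0 nat" where
  "e1 x \<equiv> Poly_Mapping.single x 1"

lemma keys_add_nat: "Poly_Mapping.keys (a + b :: 'v \<Rightarrow>\<^sub>0 nat) = Poly_Mapping.keys a \<union> Poly_Mapping.keys b"
  by (auto simp: in_keys_iff lookup_add)

lemma monom_degree_add:
  fixes a b :: "'v::finite \<Rightarrow>\<^sub>0 nat"
  shows "monom_degree (a + b) = monom_degree a + monom_degree b"
proof -
  have "monom_degree m = (\<Sum>x\<in>UNIV. Poly_Mapping.lookup m x)" for m :: "'v \<Rightarrow>\<^sub>0 nat"
    unfolding monom_degree_def by (rule sum.mono_neutral_left) (auto simp: in_keys_iff)
  then show ?thesis
    by (simp add: lookup_add sum.distrib)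
qed

lemma keys_sum_subset:
  assumes "\<And>k. k \<in> A \<Longrightarrow> Poly_Mapping.keys (f k) \<subseteq> B"
  shows "Poly_Mapping.keys (\<Sum>k\<in>A. f k) \<subseteq> B"
proof
  fix m assume "m \<in> Poly_Mapping.keys (\<Sum>k\<in>A. f k)"
  then have "(\<Sum>k\<in>A. Poly_Mapping.lookup (f k) m) \<noteq> 0"
    by (simp add: in_keys_iff lookup_sum)
  then obtain k where "k \<in> A" "Poly_Mapping.lookup (f k) m \<noteq> 0"
    by (meson sum.not_neutral_contains_not_neutral)
  then show "m \<in> B"
    using assms[of k] in_keys_iff[of m "f k"] by blast
qed

lemma keys_diff_subset:
  "Poly_Mapping.keys (p - q :: 'a \<Rightarrow>\<^sub>0 'b::ab_group_add) \<subseteq> Poly_Mapping.keys p \<union> Poly_Mapping.keys q"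
  by (auto simp: in_keys_iff lookup_minus)

lemma graded_piece_mult:
  fixes p q :: "('v::finite, 'k::field) mpoly"
  assumes "p \<in> graded_piece d" "q \<in> graded_piece e"
  shows "p * q \<in> graded_piece (d + e)"
  using assms keys_mult[of p q] by (fastforce simp: graded_piece_def monom_degree_add)

lemma graded_piece_diff:
  "p \<in> graded_piece d \<Longrightarrow> q \<in> graded_piece d \<Longrightarrow> p - q \<in> graded_piece d"
  using keys_diff_subset[of p q] by (auto simp: graded_piece_def)

lemma graded_piece_add:
  "p \<in> graded_piece d \<Longrightarrow> q \<in> graded_piece d \<Longrightarrow> p + q \<in> graded_piece d"
  using keys_add[of p q] by (auto simp: graded_piece_def)

lemma graded_piece_sum:
  "(\<And>k. k \<in> A \<Longrightarrow> f k \<in> graded_piece d) \<Longrightarrow> (\<Sum>k\<in>A. f k) \<in> graded_piece d"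
  using keys_sum_subset[of A f "{m. int (monom_degree m) = d}"] by (auto simp: graded_piece_def)

lemma zero_graded_piece: "0 \<in> graded_piece d"
  by (simp add: graded_piece_def)

lemma var_graded_piece: "var x \<in> graded_piece 1"
  by (simp add: graded_piece_def var_def monom_degree_def)

section \<open>Homogeneous components\<close>

definition restrict_keys :: "('v \<Rightarrow>\<^sub>0 nat) set \<Rightarrow> ('v, 'k::field) mpoly \<Rightarrow> ('v, 'k) mpoly" where
  "restrict_keys A p = Poly_Mapping.mapp (\<lambda>m c. c when m \<in> A) p"

lemma lookup_restrict_keys:
  "Poly_Mapping.lookup (restrict_keys A p) m = (Poly_Mapping.lookup p m when m \<in> A)"
  by (simp add: restrict_keys_def mapp.rep_eq when_def in_keys_iff)

text \<open>Exactness of a resolution is stated for whole free modules, without degrees; homogeneous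
  parts turn an arbitrary preimage under a boundary map into one of the required degree.\<close>

definition homogeneous_part :: "int \<Rightarrow> ('v, 'k::field) mpoly \<Rightarrow> ('v, 'k) mpoly" where
  "homogeneous_part d = restrict_keys {m. int (monom_degree m) = d}"

lemma homogeneous_part_in: "homogeneous_part d p \<in> graded_piece d"
  by (auto simp: homogeneous_part_def graded_piece_def in_keys_iff lookup_restrict_keys)

lemma homogeneous_part_add: "homogeneous_part d (p + q) = homogeneous_part d p + homogeneous_part d q"
  by (rule poly_mapping_eqI) (simp add: homogeneous_part_def lookup_restrict_keys lookup_add when_def)

lemma homogeneous_part_sum: "homogeneous_part d (\<Sum>k\<in>A. f k) = (\<Sum>k\<in>A. homogeneous_part d (f k))"
  by (rule poly_mapping_eqI) (simp add: homogeneous_part_def lookup_restrict_keys lookup_sum when_def)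

lemma homogeneous_part_id: "p \<in> graded_piece d \<Longrightarrow> homogeneous_part d p = p"
  by (rule poly_mapping_eqI)
    (auto simp: homogeneous_part_def lookup_restrict_keys graded_piece_def in_keys_iff when_def)

text \<open>The terms of \<open>p\<close> outside degree \<open>d\<close>, collected in
  \<open>r\<close>, land outside degree \<open>d + e\<close> after multiplication by the homogeneous
  \<open>q\<close>.\<close>

lemma homogeneous_part_mult:
  fixes p q :: "('v::finite, 'k::field) mpoly"
  assumes "q \<in> graded_piece e"
  shows "homogeneous_part (d + e) (p * q) = homogeneous_part d p * q"
proof -
  define r where "r = p - homogeneous_part d p"
  have r: "int (monom_degree m) \<noteq> d" if "m \<in> Poly_Mapping.keys r" for m
    using that
    by (auto simp: r_def homogeneous_part_def in_keys_iff lookup_minus lookup_restrict_keys when_def)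
  have "homogeneous_part (d + e) (r * q) = 0"
  proof (rule poly_mapping_eqI)
    fix m
    have "int (monom_degree m) \<noteq> d + e" if "m \<in> Poly_Mapping.keys (r * q)"
      using that keys_mult[of r q] r assms by (fastforce simp: graded_piece_def monom_degree_add)
    then show "Poly_Mapping.lookup (homogeneous_part (d + e) (r * q)) m = Poly_Mapping.lookup 0 m"
      by (auto simp: homogeneous_part_def lookup_restrict_keys in_keys_iff when_def)
  qed
  moreover have "p * q = homogeneous_part d p * q + r * q"
    by (simp add: r_def algebra_simps)
  moreover have "homogeneous_part d p * q \<in> graded_piece (d + e)"
    using assms homogeneous_part_in by (rule graded_piece_mult[rotated])
  ultimately show ?thesis
    by (simp add: homogeneous_part_add homogeneous_part_id)
qed

section \<open>Multiplication and division by monomials\<close>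

lemma lookup_single_mult:
  fixes p :: "('v, 'k::field) mpoly"
  shows "Poly_Mapping.lookup (Poly_Mapping.single a c * p) (a + m) = c * Poly_Mapping.lookup p m"
proof (induction p rule: update_induct)
  case const
  then show ?case by simp
next
  case (update f b d)
  have "Poly_Mapping.update b d f = f + Poly_Mapping.single b d"
    using update(1) by (intro poly_mapping_eqI)
      (auto simp: lookup_update lookup_add lookup_single in_keys_iff when_def)
  then show ?case
    using update by (simp add: distrib_left lookup_add mult_single lookup_single when_def)
qed

lemma keys_single_mult:
  fixes p :: "('v, 'k::field) mpoly"
  assumes "c \<noteq> 0"
  shows "Poly_Mapping.keys (Poly_Mapping.single a c * p) = (+) a ` Poly_Mapping.keys p"
proof
  show "Poly_Mapping.keys (Poly_Mapping.single a c * p) \<subseteq> (+) a ` Poly_Mapping.keys p"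
    using keys_mult[of "Poly_Mapping.single a c" p] by (auto split: if_splits)
  show "(+) a ` Poly_Mapping.keys p \<subseteq> Poly_Mapping.keys (Poly_Mapping.single a c * p)"
    using assms by (auto simp: in_keys_iff lookup_single_mult)
qed

text \<open>Subtraction of exponent vectors truncates at 0; it is exact here because the exponent of
  \<open>x\<close> in \<open>m\<close> is at least 1.\<close>

lemma keys_e1_diff:
  assumes "x \<in> Poly_Mapping.keys (m :: 'v \<Rightarrow>\<^sub>0 nat)"
  shows "e1 x + (m - e1 x) = m"
  using assms by (intro poly_mapping_eqI)
    (auto simp: lookup_add lookup_minus lookup_single in_keys_iff when_def)

text \<open>A family of vertex sets stands for the supports of the monomials in the ideal, so the ideal is
  determined by the complement of its Stanley--Reisner complex.\<close>

definition support_ideal :: "'v set set \<Rightarrow> ('v, 'k::field) mpoly set" where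
  "support_ideal F = {p. \<forall>m\<in>Poly_Mapping.keys p. Poly_Mapping.keys m \<in> F}"

text \<open>Upward closure makes \<open>support_ideal F\<close> closed under multiplication by
  arbitrary polynomials, hence an ideal.\<close>

definition up_closed :: "'v set set \<Rightarrow> bool" where
  "up_closed F \<longleftrightarrow> (\<forall>s\<in>F. \<forall>t. s \<subseteq> t \<longrightarrow> t \<in> F)"

definition colon_family :: "'v \<Rightarrow> 'v set set \<Rightarrow> 'v set set" where
  "colon_family x F = {s. insert x s \<in> F}"

lemma support_ideal_mono: "F \<subseteq> G \<Longrightarrow> p \<in> support_ideal F \<Longrightarrow> p \<in> support_ideal G"
  by (auto simp: support_ideal_def)

lemma support_ideal_zero: "0 \<in> support_ideal F"
  by (simp add: support_ideal_def)

lemma support_ideal_add: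
  "p \<in> support_ideal F \<Longrightarrow> q \<in> support_ideal F \<Longrightarrow> p + q \<in> support_ideal F"
  using keys_add[of p q] by (auto simp: support_ideal_def)

lemma support_ideal_diff:
  "p \<in> support_ideal F \<Longrightarrow> q \<in> support_ideal F \<Longrightarrow> p - q \<in> support_ideal F"
  using keys_diff_subset[of p q] by (auto simp: support_ideal_def)

lemma support_ideal_sum:
  "(\<And>k. k \<in> A \<Longrightarrow> f k \<in> support_ideal F) \<Longrightarrow> (\<Sum>k\<in>A. f k) \<in> support_ideal F"
  using keys_sum_subset[of A f "{m. Poly_Mapping.keys m \<in> F}"] by (auto simp: support_ideal_def)

lemma support_ideal_mult:
  assumes "up_closed F" "p \<in> support_ideal F"
  shows "p * q \<in> support_ideal F" "q * p \<in> support_ideal F"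
proof -
  show "p * q \<in> support_ideal F"
    using assms keys_mult[of p q] by (fastforce simp: support_ideal_def keys_add_nat up_closed_def)
  then show "q * p \<in> support_ideal F"
    by (simp add: mult.commute)
qed

text \<open>Multiplication by a variable shifts the monomials without cancellation and inserts
  \<open>x\<close> into each support. So \<open>colon_family x F\<close> is the family of the colon
  ideal \<open>I : x\<close>.\<close>

lemma var_mult_in_support_ideal_iff:
  "var x * p \<in> support_ideal F \<longleftrightarrow> p \<in> support_ideal (colon_family x F)"
  by (simp add: support_ideal_def colon_family_def var_def keys_single_mult keys_add_nat)

text \<open>The family \<open>F \<union> {s. x \<in> s}\<close> stands for the ideal
  \<open>(I, x)\<close>. An element of it splits into a multiple of \<open>x\<close> and a part in
  \<open>I\<close>, and the cofactor of \<open>x\<close> can be kept homogeneous.\<close>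

lemma support_ideal_decompose:
  fixes p :: "('v::finite, 'k::field) mpoly"
  assumes "p \<in> support_ideal (F \<union> {s. x \<in> s})" "p \<in> graded_piece d"
  shows "\<exists>u. u \<in> graded_piece (d - 1) \<and> p - var x * u \<in> support_ideal F"
proof -
  \<comment> \<open>Quotient of \<open>p\<close> by \<open>x\<close>: exponents are read off after a
    shift by \<open>e1 x\<close>, so terms not divisible by \<open>x\<close> are dropped.\<close>
  define u where "u = Poly_Mapping.map_key ((+) (e1 x)) p"
  have u: "Poly_Mapping.lookup u m = Poly_Mapping.lookup p (e1 x + m)" for m
    by (simp add: u_def map_key.rep_eq)
  have eq: "Poly_Mapping.lookup (var x * u) m = Poly_Mapping.lookup p m"
    if "x \<in> Poly_Mapping.keys m" for m
    using lookup_single_mult[of "e1 x" 1 u "m - e1 x"] that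
    by (simp only: u keys_e1_diff var_def mult_1_left)
  have "int (monom_degree m) = d - 1" if "m \<in> Poly_Mapping.keys u" for m
  proof -
    have "e1 x + m \<in> Poly_Mapping.keys p"
      using that by (simp add: in_keys_iff u)
    then have "int (monom_degree (e1 x + m)) = d"
      using assms(2) by (simp add: graded_piece_def)
    moreover have "monom_degree (e1 x) = 1"
      by (simp add: monom_degree_def)
    ultimately show ?thesis
      by (simp add: monom_degree_add)
  qed
  \<comment> \<open>All terms containing \<open>x\<close> cancel; a surviving term is a term of
    \<open>p\<close> without \<open>x\<close>, which leaves only \<open>F\<close> for its
    support.\<close>
  moreover have "Poly_Mapping.keys m \<in> F" if "m \<in> Poly_Mapping.keys (p - var x * u)" for m
  proof -
    have "x \<notin> Poly_Mapping.keys m"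
      using that eq[of m] by (auto simp only: in_keys_iff lookup_minus diff_self)
    moreover have "m \<notin> Poly_Mapping.keys (var x * u)"
      using calculation by (auto simp: var_def keys_single_mult keys_add_nat)
    ultimately have "m \<in> Poly_Mapping.keys p"
      using that keys_diff_subset by fastforce
    then show ?thesis
      using assms(1) \<open>x \<notin> Poly_Mapping.keys m\<close> by (auto simp: support_ideal_def)
  qed
  ultimately show ?thesis
    by (auto simp: graded_piece_def support_ideal_def)
qed

lemma support_ideal_UNIV: "support_ideal UNIV = UNIV"
  by (simp add: support_ideal_def)

lemma support_ideal_empty: "support_ideal {} = {0}"
  by (auto simp: support_ideal_def)

text \<open>Supports of the monomials in the edge ideal of \<open>E\<close> plus the variables in
  \<open>W\<close>. The extra variables keep the outer ideals of the exact sequence inside the class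
  covered by the induction.\<close>

definition edge_family :: "'v set set \<Rightarrow> 'v set \<Rightarrow> 'v set set" where
  "edge_family E W = {s. s \<inter> W \<noteq> {} \<or> (\<exists>e\<in>E. e \<subseteq> s)}"

lemma up_closed_edge_family: "up_closed (edge_family E W)"
  unfolding up_closed_def edge_family_def by blast

lemma edge_ideal_subset_support_ideal:
  "(edge_ideal E :: ('v::finite, 'k::field) mpoly set) \<subseteq> support_ideal (edge_family E {})"
proof -
  interpret M: module "(*) :: ('v, 'k) mpoly \<Rightarrow> _"
    by unfold_locales (simp_all add: algebra_simps)
  show ?thesis
    unfolding edge_ideal_def ideal_generated_def
  proof (rule M.span_minimal)
    show "M.subspace (support_ideal (edge_family E {}))"
      by (simp add: M.subspace_def support_ideal_zero support_ideal_add support_ideal_mult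
          up_closed_edge_family)
    show "{var x * var y | x y. {x, y} \<in> E} \<subseteq>
        (support_ideal (edge_family E {}) :: ('v, 'k) mpoly set)"
    proof
      fix p :: "('v, 'k) mpoly"
      assume "p \<in> {var x * var y | x y. {x, y} \<in> E}"
      then obtain x y where p: "p = var x * var y" and "{x, y} \<in> E"
        by blast
      moreover have "Poly_Mapping.keys (e1 x + e1 y) = {x, y}"
        by (simp add: keys_add_nat insert_commute)
      ultimately have "Poly_Mapping.keys (e1 x + e1 y) \<in> edge_family E {}"
        unfolding edge_family_def by (intro CollectI disjI2 bexI[of _ "{x, y}"]) simp_all
      then show "p \<in> support_ideal (edge_family E {})"
        by (simp add: p support_ideal_def var_def mult_single)
    qed
  qed
qed

text \<open>A monomial whose support contains an edge is a multiple of that edge's generator, so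
  membership is checked term by term. Simplicity matters: a loop would generate \<open>x^2\<close>,
  while the family would already admit \<open>x\<close>.\<close>

lemma edge_ideal_eq:
  fixes E :: "'v::finite set set"
  assumes "simple_graph E"
  shows "(edge_ideal E :: ('v, 'k::field) mpoly set) = support_ideal (edge_family E {})"
proof
  interpret M: module "(*) :: ('v, 'k) mpoly \<Rightarrow> _"
    by unfold_locales (simp_all add: algebra_simps)
  let ?S = "{var x * var y | x y. {x, y} \<in> E} :: ('v, 'k) mpoly set"
  show "(support_ideal (edge_family E {}) :: ('v, 'k) mpoly set) \<subseteq> edge_ideal E"
  proof
    fix p :: "('v, 'k) mpoly"
    assume p: "p \<in> support_ideal (edge_family E {})"
    have "Poly_Mapping.single m (Poly_Mapping.lookup p m) \<in> M.span ?S"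
      if "m \<in> Poly_Mapping.keys p" for m
    proof -
      obtain e where e: "e \<in> E" "e \<subseteq> Poly_Mapping.keys m"
        using p \<open>m \<in> Poly_Mapping.keys p\<close> by (auto simp: support_ideal_def edge_family_def)
      moreover have "card e = 2"
        using assms e by (auto simp: simple_graph_def)
      ultimately obtain x y where xy: "e = {x, y}" "x \<noteq> y"
        by (auto simp: card_2_iff)
      \<comment> \<open>Both truncated subtractions are exact, since \<open>x\<close> and
        \<open>y\<close> are distinct and lie in the support of \<open>m\<close>.\<close>
      have "m = (m - e1 x - e1 y) + (e1 x + e1 y)"
        using e xy by (intro poly_mapping_eqI)
          (auto simp: lookup_add lookup_minus lookup_single in_keys_iff when_def)
      then have single: "Poly_Mapping.single m (Poly_Mapping.lookup p m) =
          Poly_Mapping.single (m - e1 x - e1 y) (Poly_Mapping.lookup p m) * (var x * var y)"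
        by (simp add: var_def mult_single)
      have "var x * var y \<in> ?S"
        using e xy by blast
      then show ?thesis
        unfolding single by (intro M.span_scale M.span_base)
    qed
    moreover have "p = (\<Sum>m\<in>Poly_Mapping.keys p. Poly_Mapping.single m (Poly_Mapping.lookup p m))"
      by (intro poly_mapping_eqI) (auto simp: lookup_sum lookup_single when_def in_keys_iff)
    ultimately show "p \<in> edge_ideal E"
      unfolding edge_ideal_def ideal_generated_def by (metis (no_types, lifting) M.span_sum)
  qed
qed (rule edge_ideal_subset_support_ideal)

section \<open>Vanishing of Tor\<close>

lemma boundary_in_free_module: "boundary P i v \<in> free_module (rank P i)"
  by (simp add: boundary_def free_module_def)

lemma boundary_add: "boundary P i (\<lambda>k. v k + w k) = (\<lambda>l. boundary P i v l + boundary P i w l)"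
  by (auto simp: boundary_def fun_eq_iff distrib_right sum.distrib)

lemma boundary_diff: "boundary P i (\<lambda>k. v k - w k) = (\<lambda>l. boundary P i v l - boundary P i w l)"
  by (auto simp: boundary_def fun_eq_iff left_diff_distrib sum_subtractf)

lemma boundary_scale: "boundary P i (\<lambda>k. f * v k) = (\<lambda>l. f * boundary P i v l)"
  by (auto simp: boundary_def fun_eq_iff sum_distrib_left mult.assoc)

lemma boundary_in_support_ideal:
  assumes "up_closed F" "\<And>k. k < rank P (Suc i) \<Longrightarrow> v k \<in> support_ideal F"
  shows "boundary P i v l \<in> support_ideal F"
  using assms
  by (auto simp: boundary_def support_ideal_zero intro!: support_ideal_sum support_ideal_mult(1))

lemma boundary_boundary:
  assumes "residue_field_resolution P" "v \<in> free_module (rank P (Suc (Suc i)))"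
  shows "boundary P i (boundary P (Suc i) v) = (\<lambda>_. 0)"
proof -
  have "{v \<in> free_module (rank P (Suc i)). boundary P i v = (\<lambda>_. 0)} =
      boundary P (Suc i) ` free_module (rank P (Suc (Suc i)))"
    using assms(1) by (simp add: residue_field_resolution_def)
  with assms(2) show ?thesis by blast
qed

lemma boundary_tensor_chains:
  fixes P :: "('v::finite, 'k::field) free_complex"
  assumes "residue_field_resolution P" "v \<in> tensor_chains P (Suc i) j"
  shows "boundary P i v \<in> tensor_chains P i j"
proof -
  have "v k * matrix P i k l \<in> graded_piece (j - shift P i l)"
    if "k < rank P (Suc i)" "l < rank P i" for k l
  proof -
    have "v k \<in> graded_piece (j - shift P (Suc i) k)"
      "matrix P i k l \<in> graded_piece (shift P (Suc i) k - shift P i l)"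
      using assms that by (auto simp: tensor_chains_def residue_field_resolution_def)
    from graded_piece_mult[OF this] show ?thesis by simp
  qed
  then show ?thesis
    using boundary_in_free_module
    by (auto simp: tensor_chains_def boundary_def intro!: graded_piece_sum)
qed

lemma tensor_chains_add:
  "v \<in> tensor_chains P i j \<Longrightarrow> w \<in> tensor_chains P i j \<Longrightarrow> (\<lambda>k. v k + w k) \<in> tensor_chains P i j"
  by (auto simp: tensor_chains_def free_module_def graded_piece_add)

lemma tensor_chains_diff:
  "v \<in> tensor_chains P i j \<Longrightarrow> w \<in> tensor_chains P i j \<Longrightarrow> (\<lambda>k. v k - w k) \<in> tensor_chains P i j"
  by (auto simp: tensor_chains_def free_module_def graded_piece_diff)

lemma tensor_chains_var_mult:
  fixes P :: "('v::finite, 'k::field) free_complex"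
  assumes "v \<in> tensor_chains P i (j - 1)"
  shows "(\<lambda>k. var x * v k) \<in> tensor_chains P i j"
proof -
  have "var x * v k \<in> graded_piece (j - shift P i k)" if "k < rank P i" for k
    using graded_piece_mult[OF var_graded_piece, of "v k" "j - 1 - shift P i k" x] assms that
    by (simp add: tensor_chains_def)
  then show ?thesis
    using assms by (auto simp: tensor_chains_def free_module_def)
qed

lemma tensor_chains_free: "v \<in> tensor_chains P i j \<Longrightarrow> v \<in> free_module (rank P i)"
  by (simp add: tensor_chains_def)

lemma tensor_chains_decompose:
  fixes P :: "('v::finite, 'k::field) free_complex"
  assumes "v \<in> tensor_chains P i j"
    and "\<And>k. k < rank P i \<Longrightarrow> v k \<in> support_ideal (F \<union> {s. x \<in> s})"
  obtains u where "u \<in> tensor_chains P i (j - 1)"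
    and "\<And>k. v k - var x * u k \<in> support_ideal F"
proof -
  have "\<exists>u. u \<in> graded_piece (j - 1 - shift P i k) \<and> v k - var x * u \<in> support_ideal F"
    if "k < rank P i" for k
    using support_ideal_decompose[of "v k" F x "j - shift P i k"] assms that
    by (simp add: tensor_chains_def algebra_simps)
  then obtain u where u: "\<And>k. k < rank P i \<Longrightarrow> u k \<in> graded_piece (j - 1 - shift P i k)"
    "\<And>k. k < rank P i \<Longrightarrow> v k - var x * u k \<in> support_ideal F"
    by metis
  show ?thesis
  proof (rule that)
    let ?u = "\<lambda>k. if k < rank P i then u k else 0"
    show "?u \<in> tensor_chains P i (j - 1)"
      using u by (simp add: tensor_chains_def free_module_def)
    show "v k - var x * ?u k \<in> support_ideal F" for k
      using u assms(1) by (auto simp: tensor_chains_def free_module_def support_ideal_zero)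
  qed
qed

text \<open>Entries beyond the rank are zero and hence lie in every \<open>support_ideal\<close>, so
  the index bounds can go; the implication over \<open>i'\<close> treats \<open>i = 0\<close>
  uniformly with the other cases.\<close>

lemma tor_cycles_iff:
  "v \<in> tor_cycles P (support_ideal F) i j \<longleftrightarrow>
    v \<in> tensor_chains P i j \<and> (\<forall>i'. i = Suc i' \<longrightarrow> (\<forall>l. boundary P i' v l \<in> support_ideal F))"
  by (cases i) (auto simp: tor_cycles_def boundary_def support_ideal_zero)

lemma tor_boundaries_iff:
  "v \<in> tor_boundaries P (support_ideal F) i j \<longleftrightarrow>
    v \<in> tensor_chains P i j \<and>
    (\<exists>w\<in>tensor_chains P (Suc i) j. \<forall>k. v k - boundary P i w k \<in> support_ideal F)"
proof -
  have "(\<forall>k<rank P i. v k - boundary P i w k \<in> support_ideal F) \<longleftrightarrow>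
      (\<forall>k. v k - boundary P i w k \<in> support_ideal F)" if "v \<in> tensor_chains P i j" for w
    using that by (auto simp: tensor_chains_def free_module_def boundary_def support_ideal_zero
        not_less)
  then show ?thesis
    by (auto simp: tor_boundaries_def)
qed

text \<open>\<open>tor_nonzero\<close> only says that the two sets differ. With this inclusion,
  vanishing of Tor reduces to the converse one, which the following lemmas establish.\<close>

lemma tor_boundaries_subset_cycles:
  fixes P :: "('v::finite, 'k::field) free_complex"
  assumes "residue_field_resolution P" "up_closed F"
  shows "tor_boundaries P (support_ideal F) i j \<subseteq> tor_cycles P (support_ideal F) i j"
proof
  fix v assume v: "v \<in> tor_boundaries P (support_ideal F) i j"
  then obtain w where w: "w \<in> tensor_chains P (Suc i) j"
    "\<And>k. v k - boundary P i w k \<in> support_ideal F"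
    by (auto simp: tor_boundaries_iff)
  have "boundary P i' v l \<in> support_ideal F" if "i = Suc i'" for i' l
  proof -
    have "boundary P i' (\<lambda>k. v k - boundary P i w k) l \<in> support_ideal F"
      using w assms(2) by (intro boundary_in_support_ideal)
    then show ?thesis
      using boundary_boundary[OF assms(1), of w i'] w(1) that
      by (simp add: boundary_diff tensor_chains_free)
  qed
  then show "v \<in> tor_cycles P (support_ideal F) i j"
    using v by (simp add: tor_cycles_iff tor_boundaries_iff)
qed

text \<open>Half-exactness of Tor at the middle of \<open>0 \<rightarrow> S/(I : x)(-1)
  \<rightarrow> S/I \<rightarrow> S/(I, x) \<rightarrow> 0\<close>. A cycle is a boundary modulo
  \<open>(I, x)\<close>; up to \<open>I\<close>, the error is \<open>x\<close> times a cycle modulo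
  \<open>I : x\<close>, which is a boundary there.\<close>

lemma tor_vanishing_middle:
  fixes P :: "('v::finite, 'k::field) free_complex"
  assumes P: "residue_field_resolution P" and F: "up_closed F"
    and colon: "tor_cycles P (support_ideal (colon_family x F)) i (j - 1)
      \<subseteq> tor_boundaries P (support_ideal (colon_family x F)) i (j - 1)"
    and plus: "tor_cycles P (support_ideal (F \<union> {s. x \<in> s})) i j
      \<subseteq> tor_boundaries P (support_ideal (F \<union> {s. x \<in> s})) i j"
  shows "tor_cycles P (support_ideal F) i j \<subseteq> tor_boundaries P (support_ideal F) i j"
proof
  fix v assume v: "v \<in> tor_cycles P (support_ideal F) i j"
  then have "v \<in> tor_cycles P (support_ideal (F \<union> {s. x \<in> s})) i j"
    by (auto simp: tor_cycles_iff intro: support_ideal_mono[of F])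
  then obtain w where w: "w \<in> tensor_chains P (Suc i) j"
    "\<And>k. v k - boundary P i w k \<in> support_ideal (F \<union> {s. x \<in> s})"
    using plus by (auto simp: tor_boundaries_iff subset_iff)
  have "(\<lambda>k. v k - boundary P i w k) \<in> tensor_chains P i j"
    using v w P by (simp add: tor_cycles_iff tensor_chains_diff boundary_tensor_chains)
  then obtain u where u: "u \<in> tensor_chains P i (j - 1)"
    "\<And>k. v k - boundary P i w k - var x * u k \<in> support_ideal F"
    using w(2) by (rule tensor_chains_decompose) blast
  \<comment> \<open>As \<open>w\<close> contributes nothing after two boundary maps,
    \<open>x\<close> times the boundary of \<open>u\<close> agrees with the boundary of
    \<open>v\<close> modulo \<open>I\<close>, and the latter lies in \<open>I\<close>.\<close>
  have "boundary P i' u l \<in> support_ideal (colon_family x F)" if i: "i = Suc i'" for i' l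
  proof -
    have "boundary P i' (\<lambda>k. v k - boundary P i w k - var x * u k) l \<in> support_ideal F"
      using u F by (intro boundary_in_support_ideal)
    then have "boundary P i' v l - var x * boundary P i' u l \<in> support_ideal F"
      using boundary_boundary[OF P, of w i'] w(1) i
      by (simp add: boundary_diff boundary_scale tensor_chains_free)
    moreover have "boundary P i' v l \<in> support_ideal F"
      using v i by (simp add: tor_cycles_iff)
    ultimately have "var x * boundary P i' u l \<in> support_ideal F"
      using support_ideal_diff by fastforce
    then show ?thesis
      by (simp add: var_mult_in_support_ideal_iff)
  qed
  with u(1) have "u \<in> tor_cycles P (support_ideal (colon_family x F)) i (j - 1)"
    by (simp add: tor_cycles_iff)
  then obtain w' where w': "w' \<in> tensor_chains P (Suc i) (j - 1)"
    "\<And>k. u k - boundary P i w' k \<in> support_ideal (colon_family x F)"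
    using colon by (auto simp: tor_boundaries_iff subset_iff)
  let ?w = "\<lambda>k. w k + var x * w' k"
  have "?w \<in> tensor_chains P (Suc i) j"
    using w(1) w'(1) by (simp add: tensor_chains_add tensor_chains_var_mult)
  moreover have "v k - boundary P i ?w k \<in> support_ideal F" for k
  proof -
    have "v k - boundary P i ?w k =
        (v k - boundary P i w k - var x * u k) + var x * (u k - boundary P i w' k)"
      by (simp add: boundary_add boundary_scale algebra_simps)
    also have "\<dots> \<in> support_ideal F"
      using u(2) w'(2) by (intro support_ideal_add) (simp_all add: var_mult_in_support_ideal_iff)
    finally show ?thesis .
  qed
  ultimately show "v \<in> tor_boundaries P (support_ideal F) i j"
    using v by (auto simp: tor_boundaries_iff tor_cycles_iff)
qed

text \<open>Here \<open>x\<close> is a nonzerodivisor on \<open>S/I\<close>, so that \<open>Tor\<^sub>i(K, S/(I, x))\<^sub>j\<close> lies between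
  \<open>Tor\<^sub>i(K, S/I)\<^sub>j\<close> and \<open>Tor\<^sub>i\<^sub>-\<^sub>1(K, S/I)\<^sub>j\<^sub>-\<^sub>1\<close>.\<close>

lemma tor_vanishing_regular_element:
  fixes P :: "('v::finite, 'k::field) free_complex"
  assumes P: "residue_field_resolution P" and F: "up_closed F" and regular: "colon_family x F = F"
    and same: "tor_cycles P (support_ideal F) i j \<subseteq> tor_boundaries P (support_ideal F) i j"
    and shifted: "\<And>i'. i = Suc i' \<Longrightarrow>
      tor_cycles P (support_ideal F) i' (j - 1) \<subseteq> tor_boundaries P (support_ideal F) i' (j - 1)"
  shows "tor_cycles P (support_ideal (F \<union> {s. x \<in> s})) i j
    \<subseteq> tor_boundaries P (support_ideal (F \<union> {s. x \<in> s})) i j"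
proof
  fix v assume v: "v \<in> tor_cycles P (support_ideal (F \<union> {s. x \<in> s})) i j"
  \<comment> \<open>The connecting map: modulo \<open>I\<close> the boundary of \<open>v\<close> is
    \<open>x * u\<close>, and \<open>u\<close> is a cycle because \<open>x\<close> is a
    nonzerodivisor. The vanishing one step lower writes \<open>u\<close> as the boundary of
    \<open>w\<close>. For \<open>i = 0\<close> the zero chain serves.\<close>
  have "\<exists>w\<in>tensor_chains P i (j - 1). \<forall>i'. i = Suc i' \<longrightarrow>
      (\<forall>l. boundary P i' v l - var x * boundary P i' w l \<in> support_ideal F)"
  proof (cases i)
    case 0
    have "(\<lambda>_. 0) \<in> tensor_chains P i (j - 1)"
      by (simp add: tensor_chains_def free_module_def zero_graded_piece)
    with 0 show ?thesis by blast
  next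
    case (Suc i')
    have "boundary P i' v \<in> tensor_chains P i' j"
      using v P Suc by (simp add: tor_cycles_iff boundary_tensor_chains)
    moreover have "boundary P i' v k \<in> support_ideal (F \<union> {s. x \<in> s})" for k
      using v Suc by (simp add: tor_cycles_iff)
    ultimately obtain u where u: "u \<in> tensor_chains P i' (j - 1)"
      "\<And>k. boundary P i' v k - var x * u k \<in> support_ideal F"
      by (rule tensor_chains_decompose) blast
    have "boundary P i'' u l \<in> support_ideal F" if i': "i' = Suc i''" for i'' l
    proof -
      have "boundary P i'' (\<lambda>k. boundary P i' v k - var x * u k) l \<in> support_ideal F"
        using u F by (intro boundary_in_support_ideal)
      then have "0 - var x * boundary P i'' u l \<in> support_ideal F"
        using boundary_boundary[OF P, of v i''] tensor_chains_free[of v P i j] v Suc i'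
        by (simp add: boundary_diff boundary_scale tor_cycles_iff)
      from support_ideal_diff[OF support_ideal_zero this]
      show ?thesis
        by (simp add: var_mult_in_support_ideal_iff regular)
    qed
    with u(1) have "u \<in> tor_cycles P (support_ideal F) i' (j - 1)"
      by (simp add: tor_cycles_iff)
    then obtain w where w: "w \<in> tensor_chains P i (j - 1)"
      "\<And>k. u k - boundary P i' w k \<in> support_ideal F"
      using shifted[OF Suc] Suc by (auto simp: tor_boundaries_iff subset_iff)
    have "boundary P i' v l - var x * boundary P i' w l \<in> support_ideal F" for l
    proof -
      have "boundary P i' v l - var x * boundary P i' w l =
          (boundary P i' v l - var x * u l) + var x * (u l - boundary P i' w l)"
        by (simp add: algebra_simps)
      also have "\<dots> \<in> support_ideal F"
        using u(2) w(2)
        by (intro support_ideal_add) (simp_all add: var_mult_in_support_ideal_iff regular)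
      finally show ?thesis .
    qed
    with w(1) Suc show ?thesis by auto
  qed
  then obtain w where w: "w \<in> tensor_chains P i (j - 1)"
    "\<And>i' l. i = Suc i' \<Longrightarrow> boundary P i' v l - var x * boundary P i' w l \<in> support_ideal F"
    by auto
  \<comment> \<open>The correction turns \<open>v\<close> into a cycle modulo \<open>I\<close>, and
    it disappears again modulo \<open>(I, x)\<close>.\<close>
  have "(\<lambda>k. v k - var x * w k) \<in> tor_cycles P (support_ideal F) i j"
    using v w by (auto simp: tor_cycles_iff boundary_diff boundary_scale tensor_chains_diff
        tensor_chains_var_mult)
  then obtain z where z: "z \<in> tensor_chains P (Suc i) j"
    "\<And>k. v k - var x * w k - boundary P i z k \<in> support_ideal F"
    using same by (auto simp: tor_boundaries_iff subset_iff)
  have "v k - boundary P i z k \<in> support_ideal (F \<union> {s. x \<in> s})" for k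
  proof -
    have "var x * w k \<in> support_ideal (F \<union> {s. x \<in> s})"
      by (simp add: var_mult_in_support_ideal_iff colon_family_def support_ideal_UNIV)
    moreover have "v k - var x * w k - boundary P i z k \<in> support_ideal (F \<union> {s. x \<in> s})"
      using z(2) by (rule support_ideal_mono[rotated]) auto
    ultimately have "var x * w k + (v k - var x * w k - boundary P i z k)
        \<in> support_ideal (F \<union> {s. x \<in> s})"
      by (rule support_ideal_add)
    then show ?thesis by simp
  qed
  with z(1) v show "v \<in> tor_boundaries P (support_ideal (F \<union> {s. x \<in> s})) i j"
    by (auto simp: tor_boundaries_iff tor_cycles_iff)
qed

text \<open>For \<open>I = 0\<close> the complex is the resolution itself, so exactness settles
  positive \<open>i\<close>. For \<open>i = 0\<close> the homology is \<open>K\<close>, concentrated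
  in degree 0, whereas \<open>j\<close> is positive.\<close>

lemma tor_vanishing_zero_ideal:
  fixes P :: "('v::finite, 'k::field) free_complex"
  assumes P: "residue_field_resolution P" and j: "j > int i"
  shows "tor_cycles P (support_ideal {}) i j \<subseteq> tor_boundaries P (support_ideal {}) i j"
proof
  fix v assume v: "v \<in> tor_cycles P (support_ideal {}) i j"
  have "v \<in> boundary P i ` free_module (rank P (Suc i))"
  proof (cases i)
    case 0
    have "Poly_Mapping.lookup (v k) 0 * augment P k = 0" if k: "k < rank P 0" for k
    proof (cases "augment P k = 0")
      case False
      then have "shift P 0 k = 0"
        using P k by (simp add: residue_field_resolution_def)
      moreover have "v k \<in> graded_piece (j - shift P 0 k)"
        using v k 0 by (simp add: tor_cycles_iff tensor_chains_def)
      ultimately have "v k \<in> graded_piece j"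
        by simp
      \<comment> \<open>A constant term would have degree 0, but \<open>j > 0\<close>.\<close>
      then have "0 \<notin> Poly_Mapping.keys (v k)"
        using j by (auto simp: graded_piece_def monom_degree_def)
      then show ?thesis
        by (simp add: in_keys_iff)
    qed simp
    then have "augmentation P v = 0"
      unfolding augmentation_def by (intro sum.neutral) auto
    moreover have "v \<in> free_module (rank P 0)"
      using v 0 by (simp add: tor_cycles_iff tensor_chains_free)
    ultimately show ?thesis
      using P 0 by (auto simp: residue_field_resolution_def)
  next
    case (Suc i')
    then have "boundary P i' v = (\<lambda>_. 0)" "v \<in> free_module (rank P (Suc i'))"
      using v[unfolded tor_cycles_iff]
      by (auto simp: fun_eq_iff tensor_chains_def support_ideal_empty)
    then have "v \<in> {v \<in> free_module (rank P (Suc i')). boundary P i' v = (\<lambda>_. 0)}"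
      by simp
    also have "\<dots> = boundary P (Suc i') ` free_module (rank P (Suc (Suc i')))"
      using P by (simp add: residue_field_resolution_def)
    finally show ?thesis
      using Suc by simp
  qed
  then obtain w where w: "v = boundary P i w" "w \<in> free_module (rank P (Suc i))"
    by blast
  \<comment> \<open>The preimage \<open>w\<close> need not be homogeneous. Since the matrix entries
    are, its parts of the right degrees have the same image \<open>v\<close>.\<close>
  define w' where "w' k = (if k < rank P (Suc i)
    then homogeneous_part (j - shift P (Suc i) k) (w k) else 0)" for k
  have "w' \<in> tensor_chains P (Suc i) j"
    by (simp add: w'_def tensor_chains_def free_module_def homogeneous_part_in)
  moreover have "boundary P i w' l = v l" for l
  proof (cases "l < rank P i")
    case l: True
    have *: "homogeneous_part (j - shift P i l) (w k * matrix P i k l) = w' k * matrix P i k l"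
      if k: "k < rank P (Suc i)" for k
    proof -
      have "matrix P i k l \<in> graded_piece (shift P (Suc i) k - shift P i l)"
        using P k l by (simp add: residue_field_resolution_def)
      from homogeneous_part_mult[OF this, of "j - shift P (Suc i) k" "w k"] k
      show ?thesis by (simp add: w'_def)
    qed
    have "v l = homogeneous_part (j - shift P i l) (v l)"
      using v l by (simp add: tor_cycles_iff tensor_chains_def homogeneous_part_id)
    also have "\<dots> = boundary P i w' l"
      using l * by (simp add: w(1) boundary_def homogeneous_part_sum)
    finally show ?thesis ..
  qed (simp add: w(1) boundary_def)
  ultimately show "v \<in> tor_boundaries P (support_ideal {}) i j"
    using v by (auto simp: tor_boundaries_iff tor_cycles_iff support_ideal_zero
        intro!: bexI[of _ w'])
qed

text \<open>Base case of the main induction. The variables of \<open>W\<close> are added one at a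
  time, each a nonzerodivisor modulo the previous ones.\<close>

lemma tor_vanishing_variables:
  fixes P :: "('v::finite, 'k::field) free_complex"
  assumes P: "residue_field_resolution P" and j: "j > int i"
  shows "tor_cycles P (support_ideal (edge_family {} W)) i j
    \<subseteq> tor_boundaries P (support_ideal (edge_family {} W)) i j"
  using finite[of W] j
proof (induction W arbitrary: i j)
  case empty
  then show ?case
    using tor_vanishing_zero_ideal[OF P] by (simp add: edge_family_def)
next
  case (insert x W)
  have "edge_family {} (insert x W) = edge_family {} W \<union> {s. x \<in> s}"
    by (auto simp: edge_family_def)
  moreover have "colon_family x (edge_family {} W) = edge_family {} W"
    using insert.hyps by (auto simp: colon_family_def edge_family_def)
  \<comment> \<open>The bound \<open>j > int i\<close> survives lowering \<open>i\<close> and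
    \<open>j\<close> together by one, as the shifted hypothesis requires.\<close>
  ultimately show ?case
    using insert.IH insert.prems
    by (simp add: tor_vanishing_regular_element[OF P up_closed_edge_family])
qed

section \<open>Ordered matchings\<close>

definition ordered_labelling :: "'v set set \<Rightarrow> nat \<Rightarrow> (nat \<Rightarrow> 'v) \<Rightarrow> (nat \<Rightarrow> 'v) \<Rightarrow> bool" where
  "ordered_labelling E r a b \<longleftrightarrow>
     (\<forall>i\<in>{1..r}. {a i, b i} \<in> E) \<and>
     (\<forall>i\<in>{1..r}. \<forall>j\<in>{1..r}. i \<noteq> j \<longrightarrow> disjnt {a i, b i} {a j, b j}) \<and>
     independent_vertices E (a ` {1..r}) \<and>
     (\<forall>i\<in>{1..r}. \<forall>j\<in>{1..r}. {a i, b j} \<in> E \<longrightarrow> i \<le> j)"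

lemma ordered_labellingD:
  assumes "ordered_labelling E r a b"
  shows "i \<in> {1..r} \<Longrightarrow> {a i, b i} \<in> E"
    and "i \<in> {1..r} \<Longrightarrow> j \<in> {1..r} \<Longrightarrow> i \<noteq> j \<Longrightarrow> disjnt {a i, b i} {a j, b j}"
    and "independent_vertices E (a ` {1..r})"
    and "i \<in> {1..r} \<Longrightarrow> j \<in> {1..r} \<Longrightarrow> {a i, b j} \<in> E \<Longrightarrow> i \<le> j"
  using assms unfolding ordered_labelling_def by (elim conjE; blast)+

lemma ordered_matching_labelling:
  assumes "ordered_matching E M"
  obtains a b where "ordered_labelling E (card M) a b"
proof -
  obtain r :: nat and a b where M: "M = (\<lambda>i. {a i, b i}) ` {1..r}" "inj_on (\<lambda>i. {a i, b i}) {1..r}"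
    and ind: "independent_vertices E (a ` {1..r})"
    and ord: "\<forall>i\<in>{1..r}. \<forall>j\<in>{1..r}. {a i, b j} \<in> E \<longrightarrow> i \<le> j"
    using assms unfolding ordered_matching_def by blast
  have "card M = r"
    using M by (simp add: card_image)
  moreover have "disjnt {a i, b i} {a j, b j}" if "i \<in> {1..r}" "j \<in> {1..r}" "i \<noteq> j" for i j
  proof -
    have "{a i, b i} \<noteq> {a j, b j}"
      using inj_on_eq_iff[OF M(2) that(1,2)] that(3) by blast
    moreover have "{a i, b i} \<in> M" "{a j, b j} \<in> M"
      unfolding M(1) using that by blast+
    moreover have "pairwise disjnt M"
      using assms unfolding ordered_matching_def matching_def by blast
    ultimately show ?thesis
      by (metis pairwiseD)
  qed
  moreover have "{a i, b i} \<in> E" if "i \<in> {1..r}" for i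
  proof -
    have "M \<subseteq> E"
      using assms unfolding ordered_matching_def matching_def by blast
    then show ?thesis
      unfolding M(1) using that by blast
  qed
  ultimately have "ordered_labelling E (card M) a b"
    unfolding ordered_labelling_def using ind ord by blast
  then show ?thesis by (rule that)
qed

lemma labelling_ordered_matching:
  assumes "ordered_labelling E r a b" "r > 0"
  obtains M where "ordered_matching E M" "card M = r"
proof
  let ?f = "\<lambda>i. {a i, b i}"
  have disjoint: "disjnt (?f i) (?f j)" if "i \<in> {1..r}" "j \<in> {1..r}" "i \<noteq> j" for i j
    using assms(1) that by (rule ordered_labellingD(2))
  have inj: "inj_on ?f {1..r}"
  proof (rule inj_onI)
    fix i j assume "i \<in> {1..r}" "j \<in> {1..r}" "?f i = ?f j"
    then show "i = j"
      using disjoint[of i j] by (cases "i = j") (simp_all add: disjnt_def)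
  qed
  have "pairwise disjnt (?f ` {1..r})"
  proof (rule pairwiseI)
    fix e e' assume "e \<in> ?f ` {1..r}" "e' \<in> ?f ` {1..r}" "e \<noteq> e'"
    then obtain i j where "e = ?f i" "i \<in> {1..r}" "e' = ?f j" "j \<in> {1..r}" "i \<noteq> j"
      by blast
    then show "disjnt e e'"
      using disjoint[of i j] by simp
  qed
  moreover have "?f ` {1..r} \<subseteq> E"
    using ordered_labellingD(1)[OF assms(1)] by (rule image_subsetI)
  moreover have "?f ` {1..r} \<noteq> {}"
    using assms(2) by simp
  moreover have "independent_vertices E (a ` {1..r})"
    using assms(1) by (rule ordered_labellingD(3))
  moreover have "\<forall>i\<in>{1..r}. \<forall>j\<in>{1..r}. {a i, b j} \<in> E \<longrightarrow> i \<le> j"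
    using ordered_labellingD(4)[OF assms(1)] by (intro ballI impI)
  ultimately show "ordered_matching E (?f ` {1..r})"
    unfolding ordered_matching_def matching_def
    using inj by (intro conjI exI[of _ r] exI[of _ a] exI[of _ b]) (rule refl | assumption)+
  show "card (?f ` {1..r}) = r"
    using inj by (simp add: card_image)
qed

lemma ordered_labelling_le:
  fixes E :: "'v::finite set set"
  assumes "ordered_labelling E r a b"
  shows "r \<le> ordered_matching_number E"
proof (cases "r = 0")
  case False
  with assms obtain M where M: "ordered_matching E M" "card M = r"
    using labelling_ordered_matching by blast
  then have "E \<noteq> {}"
    by (auto simp: ordered_matching_def matching_def)
  moreover have "finite {card M | M. ordered_matching E M}"
    by simp
  ultimately show ?thesis
    using M by (auto simp: ordered_matching_number_def intro!: Max_ge)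
qed simp

lemma ordered_labelling_attained:
  fixes E :: "'v::finite set set"
  assumes "simple_graph E"
  obtains a b where "ordered_labelling E (ordered_matching_number E) a b"
proof (cases "E = {}")
  case True
  then have "ordered_labelling E (ordered_matching_number E) a b" for a b
    by (simp add: ordered_labelling_def ordered_matching_number_def independent_vertices_def)
  then show ?thesis by (rule that)
next
  case False
  then obtain x y where xy: "{x, y} \<in> E"
    using assms unfolding simple_graph_def by (metis card_2_iff equals0I)
  have "{x} \<notin> E"
    using assms by (auto simp: simple_graph_def)
  \<comment> \<open>A single edge is an ordered matching, so the maximum is taken over a nonempty
    set; independence of \<open>{x}\<close> is the absence of a loop.\<close>
  with xy have "ordered_labelling E 1 (\<lambda>_. x) (\<lambda>_. y)"
    by (auto simp: ordered_labelling_def independent_vertices_def)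
  then obtain M where "ordered_matching E M"
    using labelling_ordered_matching by (metis zero_less_one)
  then have "{card M | M. ordered_matching E M} \<noteq> {}"
    by blast
  then have "Max {card M | M. ordered_matching E M} \<in> {card M | M. ordered_matching E M}"
    by (intro Max_in) simp_all
  then have "ordered_matching_number E \<in> {card M | M. ordered_matching E M}"
    using False by (simp add: ordered_matching_number_def)
  then obtain M where M: "ordered_matching E M" "card M = ordered_matching_number E"
    by auto
  obtain a b where "ordered_labelling E (card M) a b"
    using M(1) by (rule ordered_matching_labelling)
  with M(2) show ?thesis
    by (intro that) simp
qed

section \<open>Passing to induced subgraphs\<close>

definition induced_edges :: "'v set set \<Rightarrow> 'v set \<Rightarrow> 'v set set" where
  "induced_edges E A = {e \<in> E. e \<subseteq> A}"

text \<open>All labelled vertices lie in \<open>A\<close>, where the induced subgraph has the same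
  adjacencies as \<open>E\<close>. Thus the conditions that forbid edges also carry over to the
  larger graph.\<close>

lemma ordered_labelling_induced:
  assumes "ordered_labelling (induced_edges E A) r a b"
  shows "ordered_labelling E r a b" "\<And>i. i \<in> {1..r} \<Longrightarrow> a i \<in> A \<and> b i \<in> A"
proof -
  have edge: "{a i, b i} \<in> induced_edges E A" if "i \<in> {1..r}" for i
    using assms that by (rule ordered_labellingD(1))
  show in_A: "a i \<in> A \<and> b i \<in> A" if "i \<in> {1..r}" for i
    using edge[OF that] by (simp add: induced_edges_def)
  have induced: "{u, v} \<in> induced_edges E A \<longleftrightarrow> {u, v} \<in> E" if "u \<in> A" "v \<in> A" for u v
    using that by (simp add: induced_edges_def)
  have "a ` {1..r} \<subseteq> A"
    using in_A by blast
  then have "independent_vertices (induced_edges E A) (a ` {1..r})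
      \<longleftrightarrow> independent_vertices E (a ` {1..r})"
    unfolding independent_vertices_def by (metis induced subsetD)
  with assms show "ordered_labelling E r a b"
    unfolding ordered_labelling_def using in_A by (simp only: induced simp_thms cong: ball_cong) blast
qed

lemma ordered_matching_number_induced:
  fixes E :: "'v::finite set set"
  assumes "simple_graph E"
  shows "ordered_matching_number (induced_edges E A) \<le> ordered_matching_number E"
proof -
  have "simple_graph (induced_edges E A)"
    using assms by (simp add: simple_graph_def induced_edges_def)
  then obtain a b where
    "ordered_labelling (induced_edges E A) (ordered_matching_number (induced_edges E A)) a b"
    by (rule ordered_labelling_attained)
  from ordered_labelling_le[OF ordered_labelling_induced(1)[OF this]] show ?thesis .
qed

text \<open>The edge \<open>{x, y}\<close> has to come last, because \<open>y\<close> may be adjacent to the earlier \<open>a i\<close>.\<close>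

lemma ordered_matching_number_neighbourhood:
  fixes E :: "'v::finite set set"
  assumes E: "simple_graph E" and xy: "{x, y} \<in> E"
  shows "Suc (ordered_matching_number (induced_edges E {z. z \<noteq> x \<and> {x, z} \<notin> E}))
    \<le> ordered_matching_number E"
proof -
  let ?A = "{z. z \<noteq> x \<and> {x, z} \<notin> E}"
  have "simple_graph (induced_edges E ?A)"
    using E by (simp add: simple_graph_def induced_edges_def)
  then obtain a b where ab: "ordered_labelling (induced_edges E ?A)
      (ordered_matching_number (induced_edges E ?A)) a b"
    by (rule ordered_labelling_attained)
  define r where "r = ordered_matching_number (induced_edges E ?A)"
  note ab = ordered_labelling_induced[OF ab[folded r_def]]
  have xx: "{x, x} \<notin> E"
    using E by (auto simp: simple_graph_def)
  \<comment> \<open>The old labels lie outside the closed neighbourhood of \<open>x\<close>, which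
    contains \<open>y\<close>.\<close>
  have avoid: "a i \<noteq> x" "b i \<noteq> x" "a i \<noteq> y" "b i \<noteq> y" "{x, a i} \<notin> E" "{a i, x} \<notin> E" "{x, b i} \<notin> E"
    if "i \<in> {1..r}" for i
    using ab(2)[OF that] xy by (auto simp: insert_commute)
  \<comment> \<open>The new \<open>a\<close>-vertex is \<open>x\<close>: having no neighbour among
    the old labels, it preserves independence and creates no edge to an earlier
    \<open>b j\<close>.\<close>
  define a' b' where "a' = a(Suc r := x)" and "b' = b(Suc r := y)"
  have old: "a' i = a i" "b' i = b i" if "i \<in> {1..r}" for i
    using that by (auto simp: a'_def b'_def)
  have new: "a' (Suc r) = x" "b' (Suc r) = y"
    by (simp_all add: a'_def b'_def)
  have range: "i \<in> {1..Suc r} \<longleftrightarrow> i = Suc r \<or> i \<in> {1..r}" for i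
    by auto
  have edges: "{a i, b i} \<in> E" if "i \<in> {1..r}" for i
    using ab(1) that by (rule ordered_labellingD(1))
  have disjoint: "disjnt {a i, b i} {a j, b j}" if "i \<in> {1..r}" "j \<in> {1..r}" "i \<noteq> j" for i j
    using ab(1) that by (rule ordered_labellingD(2))
  have independent: "{a i, a j} \<notin> E" if "i \<in> {1..r}" "j \<in> {1..r}" for i j
    using ordered_labellingD(3)[OF ab(1)] that unfolding independent_vertices_def by blast
  have ordered: "i \<le> j" if "i \<in> {1..r}" "j \<in> {1..r}" "{a i, b j} \<in> E" for i j
    using ab(1) that by (rule ordered_labellingD(4))
  have "ordered_labelling E (Suc r) a' b'"
    unfolding ordered_labelling_def independent_vertices_def
  proof (intro conjI ballI impI)
    fix i assume "i \<in> {1..Suc r}"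
    then show "{a' i, b' i} \<in> E"
      unfolding range using xy edges by (elim disjE) (simp_all only: old new)
  next
    fix i j assume "i \<in> {1..Suc r}" "j \<in> {1..Suc r}" "i \<noteq> j"
    then consider "i = Suc r" "j \<in> {1..r}" | "i \<in> {1..r}" "j = Suc r" | "i \<in> {1..r}" "j \<in> {1..r}"
      unfolding range by blast
    then show "disjnt {a' i, b' i} {a' j, b' j}"
    proof cases
      case 1
      show ?thesis
        using avoid(1-4)[OF 1(2)] unfolding 1(1) old[OF 1(2)] new disjnt_def by blast
    next
      case 2
      show ?thesis
        using avoid(1-4)[OF 2(1)] unfolding 2(2) old[OF 2(1)] new disjnt_def by blast
    next
      case 3
      show ?thesis
        using disjoint[OF 3 \<open>i \<noteq> j\<close>] unfolding old[OF 3(1)] old[OF 3(2)] .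
    qed
  next
    fix p q assume "p \<in> a' ` {1..Suc r}" "q \<in> a' ` {1..Suc r}"
    then obtain i j where ij: "p = a' i" "q = a' j" "i \<in> {1..Suc r}" "j \<in> {1..Suc r}"
      by blast
    then consider "i = Suc r" "j = Suc r" | "i = Suc r" "j \<in> {1..r}" | "i \<in> {1..r}" "j = Suc r"
      | "i \<in> {1..r}" "j \<in> {1..r}"
      unfolding range by blast
    then show "{p, q} \<notin> E"
      by cases (simp_all only: ij old new xx avoid independent not_False_eq_True)
  next
    fix i j assume "i \<in> {1..Suc r}" "j \<in> {1..Suc r}" and e: "{a' i, b' j} \<in> E"
    then consider "i = Suc r" "j = Suc r" | "i = Suc r" "j \<in> {1..r}" | "i \<in> {1..r}" "j = Suc r"
      | "i \<in> {1..r}" "j \<in> {1..r}"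
      unfolding range by blast
    then show "i \<le> j"
    proof cases
      case 2
      with e avoid[OF 2(2)] show ?thesis by (simp only: old new)
    next
      case 4
      with e ordered[OF 4] show ?thesis by (simp only: old)
    qed simp_all
  qed
  from ordered_labelling_le[OF this] show ?thesis
    by (simp add: r_def)
qed

section \<open>The regularity bound\<close>

text \<open>An edge \<open>{x, z}\<close> leaves the variable \<open>z\<close> in the colon ideal.
  Every other edge meeting the neighbourhood of \<open>x\<close> is then redundant, so only the
  edges avoiding \<open>x\<close> and its neighbours remain.\<close>

lemma colon_edge_family:
  assumes "simple_graph E" "\<Union>E \<inter> W = {}" "x \<notin> W"
  shows "colon_family x (edge_family E W) =
    edge_family (induced_edges E {z. z \<noteq> x \<and> {x, z} \<notin> E}) (W \<union> {z. {x, z} \<in> E})"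
proof (intro equalityI subsetI)
  fix s assume "s \<in> colon_family x (edge_family E W)"
  then consider "s \<inter> W \<noteq> {}" | e where "e \<in> E" "e \<subseteq> insert x s"
    using assms(3) by (auto simp: colon_family_def edge_family_def)
  then show "s \<in> edge_family (induced_edges E {z. z \<noteq> x \<and> {x, z} \<notin> E}) (W \<union> {z. {x, z} \<in> E})"
  proof cases
    case 2
    show ?thesis
    proof (cases "x \<in> e")
      case True
      have "card e = 2"
        using assms(1) 2 by (simp add: simple_graph_def)
      then obtain z where "e = {x, z}" "z \<noteq> x"
        using True by (auto simp: card_2_iff)
      then show ?thesis
        using 2 by (auto simp: edge_family_def)
    next
      \<comment> \<open>Here \<open>e\<close> lies in \<open>s\<close>: either it is an induced
        edge, or it contains a neighbour of \<open>x\<close>.\<close>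
      case False
      then show ?thesis
        using 2 by (auto simp: edge_family_def induced_edges_def)
    qed
  qed (auto simp: edge_family_def)
next
  fix s assume "s \<in> edge_family (induced_edges E {z. z \<noteq> x \<and> {x, z} \<notin> E}) (W \<union> {z. {x, z} \<in> E})"
  then show "s \<in> colon_family x (edge_family E W)"
    by (auto simp: colon_family_def edge_family_def induced_edges_def)
qed

text \<open>Edges through \<open>x\<close> are multiples of the added variable.\<close>

lemma plus_edge_family:
  "edge_family E W \<union> {s. x \<in> s} = edge_family (induced_edges E (- {x})) (insert x W)"
  by (auto simp: edge_family_def induced_edges_def)

text \<open>Disjointness of \<open>W\<close> from the vertices of the edges guarantees that the
  chosen vertex is outside \<open>W\<close>, as the colon formula requires, and is inherited by both
  smaller graphs. The internal degree \<open>j\<close> varies in the induction because the colon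
  ideal enters with a shift.\<close>

lemma tor_vanishing_edge_family:
  fixes P :: "('v::finite, 'k::field) free_complex"
  assumes P: "residue_field_resolution P"
    and "simple_graph E" "\<Union>E \<inter> W = {}" "j > int i + int (ordered_matching_number E)"
  shows "tor_cycles P (support_ideal (edge_family E W)) i j
    \<subseteq> tor_boundaries P (support_ideal (edge_family E W)) i j"
  using assms(2-)
proof (induction "card E" arbitrary: E W j rule: less_induct)
  case less
  show ?case
  proof (cases "E = {}")
    case True
    then show ?thesis
      using tor_vanishing_variables[OF P, of i j] less.prems by simp
  next
    case False
    then obtain x y where xy: "{x, y} \<in> E"
      using less.prems(1) unfolding simple_graph_def by (metis card_2_iff equals0I)
    then have x: "x \<notin> W"
      using less.prems(2) by auto
    have simple: "simple_graph (induced_edges E A)" for A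
      using less.prems(1) by (simp add: simple_graph_def induced_edges_def)
    have card: "card (induced_edges E A) < card E" if "x \<notin> A" for A
    proof (rule psubset_card_mono)
      have "{x, y} \<notin> induced_edges E A"
        using that by (simp add: induced_edges_def)
      then have "induced_edges E A \<noteq> E"
        using xy by metis
      moreover have "induced_edges E A \<subseteq> E"
        by (simp add: induced_edges_def)
      ultimately show "induced_edges E A \<subset> E"
        by (rule psubsetI[rotated])
    qed simp
    show ?thesis
    proof (rule tor_vanishing_middle[OF P up_closed_edge_family, of x])
      let ?A = "{z. z \<noteq> x \<and> {x, z} \<notin> E}"
      \<comment> \<open>The degree shift by one is paid for by the drop of the ordered matching
        number.\<close>
      have "j - 1 > int i + int (ordered_matching_number (induced_edges E ?A))"
        using ordered_matching_number_neighbourhood[OF less.prems(1) xy] less.prems(3) by linarith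
      moreover have "\<Union>(induced_edges E ?A) \<inter> (W \<union> {z. {x, z} \<in> E}) = {}"
        using less.prems(2) by (auto simp: induced_edges_def)
      ultimately show "tor_cycles P (support_ideal (colon_family x (edge_family E W))) i (j - 1)
          \<subseteq> tor_boundaries P (support_ideal (colon_family x (edge_family E W))) i (j - 1)"
        using less.hyps[OF card simple] colon_edge_family[OF less.prems(1,2) x] by simp
      \<comment> \<open>There is no shift here, so it suffices that deleting \<open>x\<close> does
        not increase the ordered matching number.\<close>
      have "j > int i + int (ordered_matching_number (induced_edges E (- {x})))"
        using ordered_matching_number_induced[OF less.prems(1), of "- {x}"] less.prems(3) by linarith
      moreover have "\<Union>(induced_edges E (- {x})) \<inter> insert x W = {}"
        using less.prems(2) by (auto simp: induced_edges_def)
      ultimately show "tor_cycles P (support_ideal (edge_family E W \<union> {s. x \<in> s})) i j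
          \<subseteq> tor_boundaries P (support_ideal (edge_family E W \<union> {s. x \<in> s})) i j"
        using less.hyps[OF card simple] unfolding plus_edge_family by simp
    qed
  qed
qed

theorem corollary2p5:
  fixes E :: "'v::finite set set"
  assumes "simple_graph E"
  shows "reg_quotient (edge_ideal E :: ('v, 'k::field) mpoly set)
           \<le> ereal (real (ordered_matching_number E))"
proof -
  have bound: "j - int i \<le> int (ordered_matching_number E)"
    if nonzero: "tor_nonzero (edge_ideal E :: ('v, 'k) mpoly set) i j" for i j
  proof (rule ccontr)
    assume "\<not> j - int i \<le> int (ordered_matching_number E)"
    then have j: "j > int i + int (ordered_matching_number E)"
      by simp
    \<comment> \<open>The vanishing holds in every resolution, so it contradicts whichever one
      witnesses \<open>tor_nonzero\<close>.\<close>
    obtain P :: "('v, 'k) free_complex" where P: "residue_field_resolution P"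
      and ne: "tor_cycles P (edge_ideal E) i j \<noteq> tor_boundaries P (edge_ideal E) i j"
      using nonzero unfolding tor_nonzero_def by blast
    have "tor_cycles P (edge_ideal E) i j \<subseteq> tor_boundaries P (edge_ideal E) i j"
      unfolding edge_ideal_eq[OF assms] by (intro tor_vanishing_edge_family P assms j) simp
    moreover have "tor_boundaries P (edge_ideal E) i j \<subseteq> tor_cycles P (edge_ideal E) i j"
      unfolding edge_ideal_eq[OF assms]
      by (intro tor_boundaries_subset_cycles P up_closed_edge_family)
    ultimately show False
      using ne by blast
  qed
  have "ereal (of_int (j - int i)) \<le> ereal (real (ordered_matching_number E))"
    if "tor_nonzero (edge_ideal E :: ('v, 'k) mpoly set) i j" for i j
  proof -
    have "(of_int (j - int i) :: real) \<le> of_int (int (ordered_matching_number E))"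
      using bound[OF that] by (rule of_int_le_iff[THEN iffD2])
    then show ?thesis
      by (simp only: ereal_less_eq of_int_of_nat_eq)
  qed
  then show ?thesis
    unfolding reg_quotient_def by (intro Sup_least) blast
qed

end
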